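(* Assume that $B$ is Hermitian positive definite. Assume that $2m-1<N$ and that $\hat\lambda\in\mathbb{R}$ satisfies $|\hat\lambda-\gamma|=\min_{i=t+1,t+2,\dots,r}|\lambda_i-\gamma|$. Then, for $k=0,1,\dots,m-1$, the matrix $S_{k,\mathrm{out}}^{(N)}\in\mathbb{C}^{n\times\ell}$ satisfies $$\left|S_{k,\mathrm{out}}^{(N)}\right|\le (n-t)\,|\hat\lambda-\gamma|^k\left(\frac{\left(\frac{\rho}{|\hat\lambda-\gamma|}\right)^{N}}{1-\left(\frac{\rho}{|\hat\lambda-\gamma|}\right)^{N}}\right)\left(\|B^{-1}\|_2\,\|V^{\mathsf H}BV\|_{\mathsf F}\right)^{1/2},$$ where $|\cdot|$ is the entrywise modulus of a matrix and the inequality means that every entry of the left-hand side is at most the scalar on the right-hand side.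
   Context: Setting. $A=A^{\mathsf H}\in\mathbb{C}^{n\times n}$, $B=B^{\mathsf H}\in\mathbb{C}^{n\times n}$, $r=\mathrm{rank}\,B$ (so $r=n$ when $B$ is positive definite), and the pencil $zB-A$ is regular. Fix a nonsingular $X=[\boldsymbol{x}_1,\dots,\boldsymbol{x}_n]\in\mathbb{C}^{n\times n}$ giving the Weierstrass canonical form $X^{\mathsf H}(zB-A)X=z\,(\mathrm{I}_r\oplus \mathrm{O})-\Lambda$ with $\Lambda=\mathrm{diag}(\lambda_1,\dots,\lambda_r)\oplus \mathrm{I}_{n-r}$, where $\oplus$ is the direct sum of matrices. The $\lambda_i\in\mathbb{R}$ ($i=1,\dots,r$) are the eigenvalues, with multiplicity, of $A\boldsymbol{x}=\lambda B\boldsymbol{x}$, with corresponding $B$-orthonormal eigenvectors $\boldsymbol{x}_i$. Let $\Omega=[a,b]\subset\mathbb{R}$ ($a<b$), $\gamma=(a+b)/2$, $\rho=(b-a)/2$. Exactly $t$ eigenvalues, $\lambda_1,\dots,\lambda_t$, lie in $\Omega$, neither $a$ nor $b$ is an eigenvalue, and $\lambda_{t+1},\dots,\lambda_r$ lie outside $\Omega$. Let $N,\ell,m$ be positive integers and $V\in\mathbb{C}^{n\times\ell}$. For $i=t+1,\dots,r$ put $$d_i^{(N)}=\frac{-\left(\frac{\rho}{\lambda_i-\gamma}\right)^N}{1-\left(\frac{\rho}{\lambda_i-\gamma}\right)^N}.$$ Let $X_{\Omega^{\mathrm c}}=[\boldsymbol{x}_{t+1},\dots,\boldsymbol{x}_r]$,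 $\Lambda_{\Omega^{\mathrm c}}=\mathrm{diag}(\lambda_{t+1},\dots,\lambda_r)$, $D_{\Omega^{\mathrm c}}^{(N)}=\mathrm{diag}(d_{t+1}^{(N)},\dots,d_r^{(N)})$, and for $k=0,\dots,m-1$ $$M_{k,\mathrm{out}}^{(N)}=X_{\Omega^{\mathrm c}}(\Lambda_{\Omega^{\mathrm c}}-\gamma \mathrm{I}_{r-t})^kD_{\Omega^{\mathrm c}}^{(N)}X_{\Omega^{\mathrm c}}^{\mathsf H},\qquad S_{k,\mathrm{out}}^{(N)}=M_{k,\mathrm{out}}^{(N)}BV.$$ $\|\cdot\|_2$ is the spectral norm and $\|\cdot\|_{\mathsf F}$ the Frobenius norm. *)

theory Defs
  imports
    "HOL-Analysis.L2_Norm"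
    "Jordan_Normal_Form.DL_Rank"
    "Jordan_Normal_Form.Gauss_Jordan_Elimination"
    "Jordan_Normal_Form.Schur_Decomposition"
begin

text \<open>
  The indices \<open>1, \<dots>, r\<close> of the eigenvalues and of the columns of \<open>X\<close> are shifted to
  \<open>0, \<dots>, r - 1\<close>, so \<open>\<lambda>\<^sub>1, \<dots>, \<lambda>\<^sub>t\<close> become \<open>lam 0, \<dots>, lam (t - 1)\<close> and
  \<open>\<lambda>\<^sub>t\<^sub>+\<^sub>1, \<dots>, \<lambda>\<^sub>r\<close> become \<open>lam t, \<dots>, lam (r - 1)\<close>.
\<close>

definition hermitian_mat :: "complex mat \<Rightarrow> bool" where
  "hermitian_mat A \<longleftrightarrow> square_mat A \<and> mat_adjoint A = A"

text \<open>
  \<open>(B *\<^sub>v x) \<bullet>c x\<close> is \<open>x\<^sup>H B x\<close>; in the order on \<open>complex\<close>, \<open>0 < z\<close> means that \<open>z\<close> is real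
  and positive.
\<close>

definition pos_def_mat :: "complex mat \<Rightarrow> bool" where
  "pos_def_mat B \<longleftrightarrow> hermitian_mat B \<and>
     (\<forall>x \<in> carrier_vec (dim_row B). x \<noteq> 0\<^sub>v (dim_row B) \<longrightarrow> 0 < (B *\<^sub>v x) \<bullet>c x)"

definition regular_pencil :: "complex mat \<Rightarrow> complex mat \<Rightarrow> bool" where
  "regular_pencil A B \<longleftrightarrow> (\<exists>z. det (z \<cdot>\<^sub>m B - A) \<noteq> 0)"

definition pencil_eigenvalue :: "complex mat \<Rightarrow> complex mat \<Rightarrow> complex \<Rightarrow> bool" where
  "pencil_eigenvalue A B \<mu> \<longleftrightarrow>
     (\<exists>x \<in> carrier_vec (dim_col A). x \<noteq> 0\<^sub>v (dim_col A) \<and> A *\<^sub>v x = \<mu> \<cdot>\<^sub>v (B *\<^sub>v x))"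

definition vec_norm2 :: "complex vec \<Rightarrow> real" where
  "vec_norm2 x = L2_set (\<lambda>i. cmod (x $ i)) {..<dim_vec x}"

definition spectral_norm :: "complex mat \<Rightarrow> real" where
  "spectral_norm A = (SUP x \<in> {x \<in> carrier_vec (dim_col A). vec_norm2 x \<le> 1}. vec_norm2 (A *\<^sub>v x))"

definition frobenius_norm :: "complex mat \<Rightarrow> real" where
  "frobenius_norm A = L2_set (\<lambda>ij. cmod (A $$ ij)) ({..<dim_row A} \<times> {..<dim_col A})"

definition weierstrass_form ::
  "nat \<Rightarrow> nat \<Rightarrow> complex mat \<Rightarrow> complex mat \<Rightarrow> complex mat \<Rightarrow> (nat \<Rightarrow> real) \<Rightarrow> bool" where
  "weierstrass_form n r A B X lam \<longleftrightarrow>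
     (\<forall>z. mat_adjoint X * (z \<cdot>\<^sub>m B - A) * X =
        z \<cdot>\<^sub>m diag_block_mat [1\<^sub>m r, 0\<^sub>m (n - r) (n - r)]
        - diag_block_mat [mat_diag r (\<lambda>i. complex_of_real (lam i)), 1\<^sub>m (n - r)])"

definition d_coeff :: "real \<Rightarrow> real \<Rightarrow> nat \<Rightarrow> real \<Rightarrow> real" where
  "d_coeff \<gamma> \<rho> N l = - ((\<rho> / (l - \<gamma>)) ^ N) / (1 - (\<rho> / (l - \<gamma>)) ^ N)"

definition X_out :: "nat \<Rightarrow> nat \<Rightarrow> nat \<Rightarrow> complex mat \<Rightarrow> complex mat" where
  "X_out n r t X = mat n (r - t) (\<lambda>(i, j). X $$ (i, t + j))"

definition Lambda_out :: "nat \<Rightarrow> nat \<Rightarrow> (nat \<Rightarrow> real) \<Rightarrow> complex mat" where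
  "Lambda_out r t lam = mat_diag (r - t) (\<lambda>j. complex_of_real (lam (t + j)))"

definition D_out :: "nat \<Rightarrow> nat \<Rightarrow> (nat \<Rightarrow> real) \<Rightarrow> real \<Rightarrow> real \<Rightarrow> nat \<Rightarrow> complex mat" where
  "D_out r t lam \<gamma> \<rho> N = mat_diag (r - t) (\<lambda>j. complex_of_real (d_coeff \<gamma> \<rho> N (lam (t + j))))"

definition M_out :: "nat \<Rightarrow> nat \<Rightarrow> nat \<Rightarrow> complex mat \<Rightarrow> (nat \<Rightarrow> real) \<Rightarrow> real \<Rightarrow> real \<Rightarrow> nat \<Rightarrow> nat
    \<Rightarrow> complex mat" where
  "M_out n r t X lam \<gamma> \<rho> N k =
     X_out n r t X * (Lambda_out r t lam - complex_of_real \<gamma> \<cdot>\<^sub>m 1\<^sub>m (r - t)) ^\<^sub>m k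
     * D_out r t lam \<gamma> \<rho> N * mat_adjoint (X_out n r t X)"

definition S_out :: "nat \<Rightarrow> nat \<Rightarrow> nat \<Rightarrow> complex mat \<Rightarrow> complex mat \<Rightarrow> complex mat \<Rightarrow> (nat \<Rightarrow> real)
    \<Rightarrow> real \<Rightarrow> real \<Rightarrow> nat \<Rightarrow> nat \<Rightarrow> complex mat" where
  "S_out n r t B V X lam \<gamma> \<rho> N k = M_out n r t X lam \<gamma> \<rho> N k * B * V"

end

theory Submission
  imports Defs
begin

text \<open>
  Positive definiteness makes \<open>B\<close> nonsingular, so \<open>r = n\<close>, and comparing the coefficients of
  \<open>z\<close> in the Weierstrass form gives \<open>X\<^sup>H B X = I\<close>. Because \<open>X\<close> is square, this one-sided identity also gives
  \<open>X X\<^sup>H = B\<^sup>-\<^sup>1\<close>. The rest is a bound on each summand of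
  \<^item> \<open>(S\<^sub>k)\<^sub>i\<^sub>j = (\<Sum>p\<ge>t. x\<^sub>i\<^sub>p * ((\<lambda>\<^sub>p - \<gamma>)\<^sup>k * d\<^sub>p) * (X\<^sup>H B V)\<^sub>p\<^sub>j)\<close>.

  The two matrix factors are entries of \<open>Y = X\<close> and of \<open>Y = (X\<^sup>H B V)\<^sup>H\<close>. In both cases an entry in
  row \<open>i\<close> is at most the square root of the diagonal entry \<open>(Y Y\<^sup>H)\<^sub>i\<^sub>i\<close>, the squared length of
  that row (\<open>norm_entry_sq_le_gram_diag\<close>). The Gram matrices are \<open>B\<^sup>-\<^sup>1\<close> and \<open>V\<^sup>H B X X\<^sup>H B V = V\<^sup>H B V\<close>,
  and an entry of a matrix is bounded by its spectral norm as well as by its Frobenius norm.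

  The scalar factor is controlled by the eigenvalue nearest to \<open>\<gamma>\<close>: for \<open>\<lambda>\<^sub>p\<close> at distance \<open>s > \<rho>\<close> from \<open>\<gamma>\<close>
  its modulus is at most
  \<open>s\<^sup>k (\<rho>/s)\<^sup>N / (1 - (\<rho>/s)\<^sup>N)\<close>, which decreases in \<open>s\<close> because \<open>k < N\<close>
  (\<open>filter_weight_le\<close>). There are \<open>n - t\<close> summands.
\<close>

section \<open>Adjoints and diagonal matrices\<close>

lemma mat_adjoint_carrier [simp]:
  assumes "A \<in> carrier_mat n m"
  shows "mat_adjoint A \<in> carrier_mat m n"
  using assms unfolding mat_adjoint_def by auto

lemma index_mat_adjoint [simp]:
  fixes A :: "complex mat"
  assumes "i < dim_col A" "j < dim_row A"
  shows "mat_adjoint A $$ (i, j) = cnj (A $$ (j, i))"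
  using assms unfolding mat_adjoint_def by (simp add: mat_of_rows_index)

lemma mat_adjoint_dims [simp]:
  "dim_row (mat_adjoint A) = dim_col A" "dim_col (mat_adjoint A) = dim_row A"
  unfolding mat_adjoint_def by auto

lemma mat_adjoint_adjoint [simp]:
  fixes A :: "complex mat"
  shows "mat_adjoint (mat_adjoint A) = A"
  by (rule eq_matI) auto

lemma mat_adjoint_mult:
  fixes A B :: "complex mat"
  assumes "A \<in> carrier_mat n m" "B \<in> carrier_mat m p"
  shows "mat_adjoint (A * B) = mat_adjoint B * mat_adjoint A"
  by (rule eq_matI) (use assms in \<open>auto simp: scalar_prod_def mult.commute\<close>)

lemma mat_diag_diff:
  fixes f g :: "nat \<Rightarrow> complex"
  shows "mat_diag n f - mat_diag n g = mat_diag n (\<lambda>i. f i - g i)"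
  unfolding mat_diag_def by (rule eq_matI) auto

lemma smult_one_eq_mat_diag:
  fixes c :: complex
  shows "c \<cdot>\<^sub>m 1\<^sub>m n = mat_diag n (\<lambda>_. c)"
  unfolding mat_diag_def by (rule eq_matI) auto

lemma mat_diag_pow:
  fixes f :: "nat \<Rightarrow> complex"
  shows "mat_diag n f ^\<^sub>m k = mat_diag n (\<lambda>i. f i ^ k)"
proof (induction k)
  case 0
  show ?case by (simp add: mat_diag_def one_mat_def cong: if_cong)
qed (simp add: mult.commute)

section \<open>Bounds on single entries of a matrix\<close>

lemma norm_entry_sq_le_gram_diag:
  fixes Y :: "complex mat"
  assumes "i < dim_row Y" "p < dim_col Y"
  shows "(cmod (Y $$ (i, p)))\<^sup>2 \<le> cmod ((Y * mat_adjoint Y) $$ (i, i))"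
proof -
  have "(Y * mat_adjoint Y) $$ (i, i) = (\<Sum>q<dim_col Y. Y $$ (i, q) * cnj (Y $$ (i, q)))"
    using assms by (auto simp: scalar_prod_def lessThan_atLeast0 intro!: sum.cong)
  also have "\<dots> = complex_of_real (\<Sum>q<dim_col Y. (cmod (Y $$ (i, q)))\<^sup>2)"
    by (simp add: complex_norm_square del: of_real_power)
  finally have "cmod ((Y * mat_adjoint Y) $$ (i, i)) = (\<Sum>q<dim_col Y. (cmod (Y $$ (i, q)))\<^sup>2)"
    by (simp only: norm_of_real) (simp add: sum_nonneg)
  moreover have "(cmod (Y $$ (i, p)))\<^sup>2 \<le> (\<Sum>q<dim_col Y. (cmod (Y $$ (i, q)))\<^sup>2)"
    using assms by (intro member_le_sum) auto
  ultimately show ?thesis by simp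
qed

lemma norm_index_le_vec_norm2:
  assumes "i < dim_vec x"
  shows "cmod (x $ i) \<le> vec_norm2 x"
  unfolding vec_norm2_def using assms by (intro member_le_L2_set) auto

text \<open>
  The supremum in \<^const>\<open>spectral_norm\<close> dominates its members only if the set is bounded; a crude
  bound is enough for this, since no coordinate of a vector in the unit ball exceeds \<open>1\<close>.
\<close>

lemma spectral_norm_bdd_above:
  fixes A :: "complex mat"
  shows "bdd_above ((\<lambda>x. vec_norm2 (A *\<^sub>v x))
           ` {x \<in> carrier_vec (dim_col A). vec_norm2 x \<le> 1})"
proof (rule bdd_aboveI2)
  fix x assume "x \<in> {x \<in> carrier_vec (dim_col A). vec_norm2 x \<le> 1}"
  then have x: "dim_vec x = dim_col A" "vec_norm2 x \<le> 1" by auto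
  have x1: "cmod (x $ j) \<le> 1" if "j < dim_col A" for j
    using norm_index_le_vec_norm2[of j x] x that by simp
  have "vec_norm2 (A *\<^sub>v x) \<le> (\<Sum>i<dim_row A. cmod ((A *\<^sub>v x) $ i))"
    unfolding vec_norm2_def dim_mult_mat_vec by (rule L2_set_le_sum) simp
  also have "\<dots> \<le> (\<Sum>i<dim_row A. \<Sum>j<dim_col A. cmod (A $$ (i, j)))"
  proof (rule sum_mono)
    fix i assume "i \<in> {..<dim_row A}"
    then have "(A *\<^sub>v x) $ i = (\<Sum>j<dim_col A. A $$ (i, j) * x $ j)"
      using x by (auto simp: scalar_prod_def lessThan_atLeast0 intro!: sum.cong)
    also have "cmod \<dots> \<le> (\<Sum>j<dim_col A. cmod (A $$ (i, j)))"
      by (rule sum_norm_le) (use x1 in \<open>auto simp: norm_mult intro!: mult_left_le\<close>)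
    finally show "cmod ((A *\<^sub>v x) $ i) \<le> (\<Sum>j<dim_col A. cmod (A $$ (i, j)))" .
  qed
  finally show "vec_norm2 (A *\<^sub>v x) \<le> (\<Sum>i<dim_row A. \<Sum>j<dim_col A. cmod (A $$ (i, j)))" .
qed

lemma norm_entry_le_spectral_norm:
  assumes "i < dim_row A" "j < dim_col A"
  shows "cmod (A $$ (i, j)) \<le> spectral_norm A"
proof -
  let ?e = "unit_vec (dim_col A) j :: complex vec"
  have "vec_norm2 ?e \<le> (\<Sum>q<dim_col A. cmod (?e $ q))"
    unfolding vec_norm2_def by (simp add: L2_set_le_sum)
  also have "\<dots> = (\<Sum>q<dim_col A. if q = j then 1 else 0)"
    by (rule sum.cong) (use assms in auto)
  also have "\<dots> = 1" using assms by simp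
  finally have e: "?e \<in> {x \<in> carrier_vec (dim_col A). vec_norm2 x \<le> 1}" by simp
  have "A $$ (i, j) = (A *\<^sub>v ?e) $ i" using assms by simp
  then have "cmod (A $$ (i, j)) \<le> vec_norm2 (A *\<^sub>v ?e)"
    using norm_index_le_vec_norm2[of i "A *\<^sub>v ?e"] assms by simp
  also have "\<dots> \<le> spectral_norm A"
    unfolding spectral_norm_def by (rule cSUP_upper[OF e spectral_norm_bdd_above])
  finally show ?thesis .
qed

lemma norm_entry_le_frobenius_norm:
  assumes "i < dim_row A" "j < dim_col A"
  shows "cmod (A $$ (i, j)) \<le> frobenius_norm A"
  unfolding frobenius_norm_def using assms
  by (intro member_le_L2_set[where f = "\<lambda>ij. cmod (A $$ ij)"]) auto

section \<open>The Weierstrass form of a positive definite pencil\<close>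

lemma pos_def_mat_det_nonzero:
  assumes B: "B \<in> carrier_mat n n" and "pos_def_mat B"
  shows "det B \<noteq> 0"
proof
  assume "det B = 0"
  then obtain v where v: "v \<in> carrier_vec n" "v \<noteq> 0\<^sub>v n" "B *\<^sub>v v = 0\<^sub>v n"
    using det_0_iff_vec_prod_zero[OF B] by auto
  then have "0 < (B *\<^sub>v v) \<bullet>c v" using assms unfolding pos_def_mat_def by auto
  then show False using v by simp
qed

lemma pos_def_mat_rank:
  assumes "B \<in> carrier_mat n n" "pos_def_mat B"
  shows "vec_space.rank n B = n"
  using vec_space.det_rank_iff[OF assms(1)] pos_def_mat_det_nonzero[OF assms] by blast

lemma mat_pencil_leading_eqI:
  fixes P Q R S :: "'a :: comm_ring_1 mat"
  assumes dims: "P \<in> carrier_mat n m" "Q \<in> carrier_mat n m" "R \<in> carrier_mat n m" "S \<in> carrier_mat n m"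
    and eq: "\<And>z. z \<cdot>\<^sub>m P - Q = z \<cdot>\<^sub>m R - S"
  shows "P = R"
proof (rule eq_matI)
  fix i j assume ij: "i < dim_row R" "j < dim_col R"
  have "z * P $$ (i, j) - Q $$ (i, j) = z * R $$ (i, j) - S $$ (i, j)" for z
    using arg_cong[OF eq[of z], of "\<lambda>M. M $$ (i, j)"] dims ij by simp
  from this[of 0] this[of 1] show "P $$ (i, j) = R $$ (i, j)" by simp
qed (use dims in auto)

text \<open>
  The identity holds for every \<open>z\<close>, so the coefficients of \<open>z\<close> on its two sides agree; for \<open>r = n\<close> the
  one on the right is \<open>I\<close>.
\<close>

lemma weierstrass_form_B_orthonormal:
  assumes A: "A \<in> carrier_mat n n" and B: "B \<in> carrier_mat n n" and X: "X \<in> carrier_mat n n"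
    and W: "weierstrass_form n n A B X lam"
  shows "mat_adjoint X * B * X = 1\<^sub>m n"
proof -
  let ?L = "mat_diag n (\<lambda>i. complex_of_real (lam i))"
  have I: "diag_block_mat [1\<^sub>m n, 0\<^sub>m (n - n) (n - n)] = (1\<^sub>m n :: complex mat)"
    by (rule eq_matI) (auto simp: Let_def)
  have L: "diag_block_mat [?L, 1\<^sub>m (n - n)] = ?L"
    by (rule eq_matI) (auto simp: Let_def mat_diag_def)
  have Xh: "mat_adjoint X \<in> carrier_mat n n" using X by simp
  have W': "z \<cdot>\<^sub>m (mat_adjoint X * B * X) - mat_adjoint X * A * X = z \<cdot>\<^sub>m 1\<^sub>m n - ?L" for z
  proof -
    have zB: "z \<cdot>\<^sub>m B \<in> carrier_mat n n" using B by simp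
    have "mat_adjoint X * (z \<cdot>\<^sub>m B - A) * X
        = mat_adjoint X * (z \<cdot>\<^sub>m B) * X - mat_adjoint X * A * X"
      by (subst mult_minus_distrib_mat[OF Xh zB A], rule minus_mult_distrib_mat)
        (use X mult_carrier_mat[OF Xh zB] mult_carrier_mat[OF Xh A] in auto)
    also have "mat_adjoint X * (z \<cdot>\<^sub>m B) * X = z \<cdot>\<^sub>m (mat_adjoint X * B * X)"
      by (simp only: mult_smult_distrib[OF Xh B] mult_smult_assoc_mat[OF mult_carrier_mat[OF Xh B] X])
    finally show ?thesis using W unfolding weierstrass_form_def I L by metis
  qed
  show ?thesis
    by (rule mat_pencil_leading_eqI[OF _ _ _ _ W']) (use Xh A B X in auto)
qed

lemma mat_inverse_eqI:
  fixes B C :: "complex mat"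
  assumes B: "B \<in> carrier_mat n n" and C: "C \<in> carrier_mat n n" and BC: "B * C = 1\<^sub>m n"
  shows "mat_inverse B = Some C"
proof -
  have CB: "C * B = 1\<^sub>m n" by (rule mat_mult_left_right_inverse[OF B C BC])
  have "B \<in> Units (ring_mat TYPE(complex) n ())"
    using B C BC CB unfolding Units_def ring_mat_def by auto
  then obtain D where D: "mat_inverse B = Some D"
    using mat_inverse(1)[OF B, where b = "()"] by (cases "mat_inverse B") auto
  then have "B * D = 1\<^sub>m n" "D \<in> carrier_mat n n" using mat_inverse(2)[OF B] by auto
  then have "C * (B * D) = C" using C by simp
  moreover have "C * (B * D) = D"
    using \<open>D \<in> carrier_mat n n\<close> B C CB by (metis assoc_mult_mat left_mult_one_mat)
  ultimately show ?thesis using D by simp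
qed

section \<open>The scalar weights\<close>

text \<open>
  With \<open>s = \<bar>x\<bar>\<close> and \<open>q = \<rho>/s < 1\<close>, the numerator \<open>s\<^sup>k q\<^sup>N = \<rho>\<^sup>k q\<^sup>N\<^sup>-\<^sup>k\<close> grows with \<open>q\<close> and
  \<open>1 - q\<^sup>N\<close> shrinks. In modulus the sign of \<open>x\<close> matters only for the denominator \<open>1 - (\<rho>/x)\<^sup>N\<close>, which
  is at least \<open>1 - q\<^sup>N\<close> either way.
\<close>

lemma filter_weight_le:
  fixes \<rho> h x :: real
  assumes "0 < \<rho>" "\<rho> < h" "h \<le> \<bar>x\<bar>" "k \<le> N" "0 < N"
  shows "\<bar>x ^ k * (- ((\<rho> / x) ^ N) / (1 - (\<rho> / x) ^ N))\<bar>
           \<le> h ^ k * ((\<rho> / h) ^ N / (1 - (\<rho> / h) ^ N))"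
proof -
  define p q where "p = \<rho> / h" and "q = \<rho> / \<bar>x\<bar>"
  have s: "0 < h" "0 < \<bar>x\<bar>" using assms by linarith+
  have pq: "0 < q" "q \<le> p" "p < 1" "h * p = \<rho>" "\<bar>x\<bar> * q = \<rho>"
    using assms s unfolding p_def q_def by (auto simp: frac_le)
  have collect: "c ^ k * d ^ N = (c * d) ^ k * d ^ (N - k)" for c d :: real
    using \<open>k \<le> N\<close> by (simp add: power_mult_distrib flip: power_add)
  have num: "\<bar>x\<bar> ^ k * q ^ N \<le> h ^ k * p ^ N"
    unfolding collect pq using pq assms by (intro mult_left_mono power_mono) auto
  have "q ^ N \<le> p ^ N" using pq by (intro power_mono) auto
  moreover have "p ^ N < 1"
    using power_Suc_less_one[of p "N - 1"] pq \<open>0 < N\<close> by simp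
  moreover have "\<bar>(\<rho> / x) ^ N\<bar> = q ^ N"
    using assms by (simp add: q_def power_abs abs_divide)
  ultimately have den: "0 < 1 - p ^ N" "1 - p ^ N \<le> \<bar>1 - (\<rho> / x) ^ N\<bar>"
    and abs_num: "\<bar>(\<rho> / x) ^ N\<bar> = q ^ N" by linarith+
  have "\<bar>x ^ k * (- ((\<rho> / x) ^ N) / (1 - (\<rho> / x) ^ N))\<bar>
      = (\<bar>x\<bar> ^ k * q ^ N) / \<bar>1 - (\<rho> / x) ^ N\<bar>"
    using abs_num by (simp add: abs_mult power_abs)
  also have "\<dots> \<le> (h ^ k * p ^ N) / (1 - p ^ N)"
    using num den pq s by (intro frac_le) auto
  finally show ?thesis by (simp add: p_def)
qed

section \<open>The contribution of the outer eigenvalues\<close>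

lemma S_out_index:
  assumes B: "B \<in> carrier_mat n n" and X: "X \<in> carrier_mat n n" and V: "V \<in> carrier_mat n l"
    and r: "r \<le> n" and i: "i < n" and j: "j < l"
  shows "S_out n r t B V X lam \<gamma> \<rho> N k $$ (i, j) =
    (\<Sum>p<r - t. X $$ (i, t + p)
        * complex_of_real ((lam (t + p) - \<gamma>) ^ k * d_coeff \<gamma> \<rho> N (lam (t + p)))
        * (mat_adjoint X * (B * V)) $$ (t + p, j))"
proof -
  define f where
    "f = (\<lambda>p. complex_of_real ((lam (t + p) - \<gamma>) ^ k * d_coeff \<gamma> \<rho> N (lam (t + p))))"
  let ?Y = "X_out n r t X" and ?L = "Lambda_out r t lam - complex_of_real \<gamma> \<cdot>\<^sub>m 1\<^sub>m (r - t)"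
  have Y: "?Y \<in> carrier_mat n (r - t)" unfolding X_out_def by simp
  then have Yh: "mat_adjoint ?Y \<in> carrier_mat (r - t) n" by simp
  have diag: "?L ^\<^sub>m k * D_out r t lam \<gamma> \<rho> N = mat_diag (r - t) f"
    unfolding Lambda_out_def D_out_def smult_one_eq_mat_diag mat_diag_diff mat_diag_pow
      mat_diag_diag by (simp add: f_def)
  have Lk: "?L ^\<^sub>m k \<in> carrier_mat (r - t) (r - t)" "D_out r t lam \<gamma> \<rho> N \<in> carrier_mat (r - t) (r - t)"
    unfolding Lambda_out_def D_out_def smult_one_eq_mat_diag mat_diag_diff mat_diag_pow by simp_all
  have YD: "?Y * mat_diag (r - t) f \<in> carrier_mat n (r - t)" using Y by simp
  have "S_out n r t B V X lam \<gamma> \<rho> N k = ?Y * mat_diag (r - t) f * mat_adjoint ?Y * B * V"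
    unfolding S_out_def M_out_def using assoc_mult_mat[OF Y Lk] by (simp add: diag)
  also have "\<dots> = ?Y * mat_diag (r - t) f * (mat_adjoint ?Y * (B * V))"
    by (simp only: assoc_mult_mat[OF mult_carrier_mat[OF YD Yh] B V]
        assoc_mult_mat[OF YD Yh mult_carrier_mat[OF B V]])
  also have "\<dots> $$ (i, j) = (\<Sum>p<r - t. (?Y * mat_diag (r - t) f) $$ (i, p)
      * (mat_adjoint ?Y * (B * V)) $$ (p, j))"
    using YD Yh B V Y i j
    by (subst index_mult_mat(1)) (auto simp: scalar_prod_def lessThan_atLeast0 X_out_def intro!: sum.cong)
  also have "\<dots> = (\<Sum>p<r - t. X $$ (i, t + p) * f p * (mat_adjoint X * (B * V)) $$ (t + p, j))"
  proof (rule sum.cong[OF refl])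
    fix p assume "p \<in> {..<r - t}"
    then have p: "p < r - t" "t + p < n" using r by auto
    have "row (mat_adjoint ?Y) p = row (mat_adjoint X) (t + p)"
      by (rule eq_vecI) (use p X in \<open>auto simp: X_out_def\<close>)
    then have "(mat_adjoint ?Y * (B * V)) $$ (p, j) = (mat_adjoint X * (B * V)) $$ (t + p, j)"
      using p X Y V j by simp
    moreover have "(?Y * mat_diag (r - t) f) $$ (i, p) = X $$ (i, t + p) * f p"
      unfolding mat_diag_mult_right[OF Y] using p i by (simp add: X_out_def)
    ultimately show "(?Y * mat_diag (r - t) f) $$ (i, p) * (mat_adjoint ?Y * (B * V)) $$ (p, j)
        = X $$ (i, t + p) * f p * (mat_adjoint X * (B * V)) $$ (t + p, j)" by simp
  qed
  finally show ?thesis by (simp add: f_def)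
qed

lemma norm_eigenvector_entry_le:
  assumes B: "B \<in> carrier_mat n n" and X: "X \<in> carrier_mat n n"
    and inv: "B * (X * mat_adjoint X) = 1\<^sub>m n" and i: "i < n" and p: "p < n"
  shows "cmod (X $$ (i, p)) \<le> sqrt (spectral_norm (the (mat_inverse B)))"
proof -
  have "mat_inverse B = Some (X * mat_adjoint X)"
    by (rule mat_inverse_eqI[OF B _ inv]) (use X in simp)
  moreover have "(cmod (X $$ (i, p)))\<^sup>2 \<le> cmod ((X * mat_adjoint X) $$ (i, i))"
    by (rule norm_entry_sq_le_gram_diag) (use X i p in auto)
  moreover have "\<dots> \<le> spectral_norm (X * mat_adjoint X)"
    by (rule norm_entry_le_spectral_norm) (use X i in auto)
  ultimately show ?thesis by (intro real_le_rsqrt) simp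
qed

text \<open>
  The entry is the conjugate of \<open>Y\<^sub>j\<^sub>p\<close> for \<open>Y = (X\<^sup>H B V)\<^sup>H = V\<^sup>H B X\<close>, and
  \<open>Y Y\<^sup>H = V\<^sup>H (B X X\<^sup>H) B V\<close> collapses to \<open>V\<^sup>H B V\<close>.
\<close>

lemma norm_eigenvector_coefficient_le:
  assumes B: "B \<in> carrier_mat n n" "mat_adjoint B = B" and X: "X \<in> carrier_mat n n"
    and V: "V \<in> carrier_mat n l"
    and inv: "B * (X * mat_adjoint X) = 1\<^sub>m n" and p: "p < n" and j: "j < l"
  shows "cmod ((mat_adjoint X * (B * V)) $$ (p, j))
           \<le> sqrt (frobenius_norm (mat_adjoint V * B * V))"
proof -
  define Y where "Y = mat_adjoint (mat_adjoint X * (B * V))"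
  have Xh: "mat_adjoint X \<in> carrier_mat n n" and Vh: "mat_adjoint V \<in> carrier_mat l n"
    and BV: "B * V \<in> carrier_mat n l" using X V B by auto
  have W: "mat_adjoint X * (B * V) \<in> carrier_mat n l" using Xh BV by simp
  have Y: "Y = mat_adjoint V * B * X"
    unfolding Y_def using mat_adjoint_mult[OF Xh BV] mat_adjoint_mult[OF B(1) V] B(2) by simp
  have "Y * mat_adjoint Y = mat_adjoint V * B * X * (mat_adjoint X * (B * V))"
    unfolding Y[symmetric] unfolding Y_def by simp
  also have "\<dots> = mat_adjoint V * (B * (X * mat_adjoint X)) * (B * V)"
  proof -
    have "mat_adjoint V * B * X * (mat_adjoint X * (B * V))
        = mat_adjoint V * B * X * mat_adjoint X * (B * V)"
      by (rule assoc_mult_mat[symmetric]) (use B Vh X Xh BV in auto)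
    also have "mat_adjoint V * B * X * mat_adjoint X = mat_adjoint V * B * (X * mat_adjoint X)"
      by (rule assoc_mult_mat) (use B Vh X Xh in auto)
    also have "\<dots> = mat_adjoint V * (B * (X * mat_adjoint X))"
      by (rule assoc_mult_mat) (use B Vh X Xh in auto)
    finally show ?thesis .
  qed
  also have "\<dots> = mat_adjoint V * B * V"
    unfolding inv right_mult_one_mat[OF Vh] by (rule assoc_mult_mat[OF Vh B(1) V, symmetric])
  finally have gram: "Y * mat_adjoint Y = mat_adjoint V * B * V" .
  have "cmod ((mat_adjoint X * (B * V)) $$ (p, j)) = cmod (Y $$ (j, p))"
    unfolding Y_def using X V p j by (simp del: index_mult_mat(1))
  moreover have "(cmod (Y $$ (j, p)))\<^sup>2 \<le> cmod ((Y * mat_adjoint Y) $$ (j, j))"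
    by (rule norm_entry_sq_le_gram_diag) (use W p j in \<open>auto simp: Y_def\<close>)
  moreover have "cmod ((mat_adjoint V * B * V) $$ (j, j)) \<le> frobenius_norm (mat_adjoint V * B * V)"
    by (rule norm_entry_le_frobenius_norm) (use V j in auto)
  ultimately show ?thesis by (intro real_le_rsqrt) (simp add: gram del: index_mult_mat(1))
qed

theorem theorem2p7:
  fixes A B X V :: "complex mat"
    and n r t N m l k :: nat
    and lam :: "nat \<Rightarrow> real"
    and a b \<gamma> \<rho> lamhat :: real
  assumes A: "A \<in> carrier_mat n n" "hermitian_mat A"
    and B: "B \<in> carrier_mat n n" "hermitian_mat B"
    and r: "r = vec_space.rank n B"
    and regular: "regular_pencil A B"
    and X: "X \<in> carrier_mat n n" "invertible_mat X"
    and weierstrass: "weierstrass_form n r A B X lam"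
    and interval: "a < b" "\<gamma> = (a + b) / 2" "\<rho> = (b - a) / 2"
    and t: "t \<le> r"
    and inside: "\<forall>i<t. lam i \<in> {a..b}"
    and outside: "\<forall>i\<in>{t..<r}. lam i \<notin> {a..b}"
    and endpoints: "\<not> pencil_eigenvalue A B (complex_of_real a)"
      "\<not> pencil_eigenvalue A B (complex_of_real b)"
    and pos: "0 < N" "0 < l" "0 < m"
    and V: "V \<in> carrier_mat n l"
    and B_pos_def: "pos_def_mat B"
    and m_N: "2 * m - 1 < N"
    and lamhat: "\<bar>lamhat - \<gamma>\<bar> = Min ((\<lambda>i. \<bar>lam i - \<gamma>\<bar>) ` {t..<r})"
    and k: "k < m"
  shows "\<forall>i<n. \<forall>j<l.
    cmod (S_out n r t B V X lam \<gamma> \<rho> N k $$ (i, j)) \<le>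
      (real n - real t) * \<bar>lamhat - \<gamma>\<bar> ^ k
      * ((\<rho> / \<bar>lamhat - \<gamma>\<bar>) ^ N / (1 - (\<rho> / \<bar>lamhat - \<gamma>\<bar>) ^ N))
      * sqrt (spectral_norm (the (mat_inverse B)) * frobenius_norm (mat_adjoint V * B * V))"
proof (intro allI impI)
  fix i j assume i: "i < n" and j: "j < l"
  let ?sN = "spectral_norm (the (mat_inverse B))"
  let ?fN = "frobenius_norm (mat_adjoint V * B * V)"
  let ?c = "\<bar>lamhat - \<gamma>\<bar> ^ k
      * ((\<rho> / \<bar>lamhat - \<gamma>\<bar>) ^ N / (1 - (\<rho> / \<bar>lamhat - \<gamma>\<bar>) ^ N))"
  have rn: "r = n" using r pos_def_mat_rank[OF B(1) B_pos_def] by simp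
  have Xh: "mat_adjoint X \<in> carrier_mat n n" using X by simp
  have "mat_adjoint X * B * X = 1\<^sub>m n"
    using weierstrass_form_B_orthonormal[OF A(1) B(1) X(1)] weierstrass rn by simp
  then have "mat_adjoint X * (B * X) = 1\<^sub>m n" using assoc_mult_mat[OF Xh B(1) X(1)] by simp
  then have "B * X * mat_adjoint X = 1\<^sub>m n"
    using mat_mult_left_right_inverse[OF Xh, of "B * X"] B(1) X(1) by simp
  then have inv: "B * (X * mat_adjoint X) = 1\<^sub>m n" using assoc_mult_mat[OF B(1) X(1) Xh] by simp
  have "0 < \<rho>" using interval by simp
  \<comment> \<open>If \<open>t = n\<close>, the minimum ranges over the empty set, but then there is no \<open>p\<close> to consider.\<close>
  have weight: "\<bar>(lam (t + p) - \<gamma>) ^ k * d_coeff \<gamma> \<rho> N (lam (t + p))\<bar> \<le> ?c" if p: "p < n - t" for p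
  proof -
    have "Min ((\<lambda>i. \<bar>lam i - \<gamma>\<bar>) ` {t..<r}) \<in> (\<lambda>i. \<bar>lam i - \<gamma>\<bar>) ` {t..<r}"
      by (rule Min_in) (use p rn in auto)
    then obtain q where q: "q \<in> {t..<r}" "\<bar>lamhat - \<gamma>\<bar> = \<bar>lam q - \<gamma>\<bar>" using lamhat by auto
    have "\<rho> < \<bar>lam q - \<gamma>\<bar>"
      using bspec[OF outside q(1)] interval by (auto simp: abs_real_def field_simps)
    moreover have "\<bar>lamhat - \<gamma>\<bar> \<le> \<bar>lam (t + p) - \<gamma>\<bar>"
      unfolding lamhat by (rule Min_le) (use p rn in auto)
    ultimately show ?thesis
      unfolding d_coeff_def using q(2) \<open>0 < \<rho>\<close> k m_N pos by (intro filter_weight_le) linarith+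
  qed
  have "cmod (S_out n r t B V X lam \<gamma> \<rho> N k $$ (i, j)) \<le> (\<Sum>p<n - t. sqrt ?sN * ?c * sqrt ?fN)"
    unfolding rn S_out_index[OF B(1) X(1) V order_refl i j]
  proof (rule sum_norm_le)
    fix p assume "p \<in> {..<n - t}"
    then have p: "p < n - t" "t + p < n" by auto
    have x: "cmod (X $$ (i, t + p)) \<le> sqrt ?sN"
      by (rule norm_eigenvector_entry_le[OF B(1) X(1) inv i p(2)])
    have v: "cmod ((mat_adjoint X * (B * V)) $$ (t + p, j)) \<le> sqrt ?fN"
      using norm_eigenvector_coefficient_le[OF B(1) _ X(1) V inv p(2) j] B(2)
      unfolding hermitian_mat_def by simp
    have nonneg: "0 \<le> sqrt ?sN" "0 \<le> ?c"
      using order_trans[OF norm_ge_zero x] order_trans[OF abs_ge_zero weight[OF p(1)]] .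
    show "cmod (X $$ (i, t + p)
        * complex_of_real ((lam (t + p) - \<gamma>) ^ k * d_coeff \<gamma> \<rho> N (lam (t + p)))
        * (mat_adjoint X * (B * V)) $$ (t + p, j)) \<le> sqrt ?sN * ?c * sqrt ?fN"
      unfolding norm_mult norm_of_real
      by (intro mult_mono x v mult_nonneg_nonneg nonneg norm_ge_zero abs_ge_zero weight[OF p(1)])
  qed
  also have "\<dots> = (real n - real t) * ?c * sqrt (?sN * ?fN)"
    using t rn by (simp add: of_nat_diff real_sqrt_mult)
  finally show "cmod (S_out n r t B V X lam \<gamma> \<rho> N k $$ (i, j)) \<le> (real n - real t) * \<bar>lamhat - \<gamma>\<bar> ^ k
      * ((\<rho> / \<bar>lamhat - \<gamma>\<bar>) ^ N / (1 - (\<rho> / \<bar>lamhat - \<gamma>\<bar>) ^ N)) * sqrt (?sN * ?fN)"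
    by (simp only: mult.assoc)
qed

end
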